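(* Let $U$ be an ultrafilter on a set $X$ and $W$ an ultrafilter on a set $Y$ such that $U\ltimes W=U\rtimes W$. Then for all infinite cardinals $\lambda$, either $U$ or $W$ is $(\lambda,\lambda^+)$-indecomposable.
   Context: For $R\subseteq X\times Y$, write $(R)_x=\{y\in Y:(x,y)\in R\}$ and $(R)^y=\{x\in X:(x,y)\in R\}$. The left and right tensor products are $U\ltimes W=\{R\subseteq X\times Y:\{x\in X:(R)_x\in W\}\in U\}$ and $U\rtimes W=\{R\subseteq X\times Y:\{y\in Y:(R)^y\in U\}\in W\}$. For cardinals $\lambda\leq\eta$, an ultrafilter $U$ is $(\lambda,\eta)$-indecomposable if for every family of sets $\mathcal P$ of cardinality at most $\eta$ with $\bigcup\mathcal P\in U$, there is some $\mathcal Q\subseteq\mathcal P$ of cardinality less than $\lambda$ such that $\bigcup\mathcal Q\in U$. Here $\lambda^+$ is the successor cardinal of $\lambda$. *)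

theory Defs
  imports Main
begin

unbundle cardinal_syntax

text \<open>Principal ultrafilters are allowed; properness forces \<open>X\<close> to be nonempty.\<close>

definition ultrafilter_on :: "'a set \<Rightarrow> 'a set set \<Rightarrow> bool" where
  "ultrafilter_on X U \<longleftrightarrow>
     U \<subseteq> Pow X \<and> X \<in> U \<and> {} \<notin> U \<and>
     (\<forall>A B. A \<in> U \<longrightarrow> B \<in> U \<longrightarrow> A \<inter> B \<in> U) \<and>
     (\<forall>A B. A \<in> U \<longrightarrow> A \<subseteq> B \<longrightarrow> B \<subseteq> X \<longrightarrow> B \<in> U) \<and>
     (\<forall>A. A \<subseteq> X \<longrightarrow> A \<in> U \<or> X - A \<in> U)"

definition left_tensor ::
    "'a set \<Rightarrow> 'b set \<Rightarrow> 'a set set \<Rightarrow> 'b set set \<Rightarrow> ('a \<times> 'b) set set" where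
  "left_tensor X Y U W =
     {R. R \<subseteq> X \<times> Y \<and> {x \<in> X. {y \<in> Y. (x, y) \<in> R} \<in> W} \<in> U}"

definition right_tensor ::
    "'a set \<Rightarrow> 'b set \<Rightarrow> 'a set set \<Rightarrow> 'b set set \<Rightarrow> ('a \<times> 'b) set set" where
  "right_tensor X Y U W =
     {R. R \<subseteq> X \<times> Y \<and> {y \<in> Y. {x \<in> X. (x, y) \<in> R} \<in> U} \<in> W}"

text \<open>
  Cardinals are represented, as in the HOL library, by relations \<open>r\<close> with \<open>Card_order r\<close>,
  compared across types by \<open>\<le>o\<close> and \<open><o\<close>. The notion below is meant for cardinals
  with \<open>\<kappa> \<le>o \<eta>\<close>. The underlying set of the ultrafilter need not be
  mentioned: \<open>\<Union>P \<in> U\<close> already forces the members of \<open>P\<close> to be subsets of it.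
\<close>

definition indecomposable :: "'c rel \<Rightarrow> 'd rel \<Rightarrow> 'a set set \<Rightarrow> bool" where
  "indecomposable \<kappa> \<eta> U \<longleftrightarrow>
     (\<forall>P. |P| \<le>o \<eta> \<and> \<Union>P \<in> U \<longrightarrow> (\<exists>Q\<subseteq>P. |Q| <o \<kappa> \<and> \<Union>Q \<in> U))"

end

theory Submission
  imports Defs
begin

text \<open>
  If \<open>U\<close> is not \<open>(\<kappa>, \<kappa>\<^sup>+)\<close>-indecomposable, it has a uniform image on \<open>\<kappa>\<close> or on \<open>\<kappa>\<^sup>+\<close>, and so does \<open>W\<close>.
  When both images live on the same cardinal, the order relation distinguishes the two tensor
  products. Otherwise let \<open>U\<close> be uniform on \<open>\<kappa>\<close> and \<open>W\<close> on \<open>\<kappa>\<^sup>+\<close>, and fix injections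
  \<open>F \<alpha> : \<alpha> \<rightarrow> \<kappa>\<close> for \<open>\<alpha> < \<kappa>\<^sup>+\<close>. Commuting the quantifiers in
  \<open>\<forall>\<^sub>W \<alpha>. \<forall>\<^sub>U \<xi>. F \<alpha> \<beta> < \<xi>\<close> gives for each \<open>\<beta>\<close> some \<open>\<xi>\<close> with \<open>F \<alpha> \<beta> < \<xi>\<close> for
  \<open>W\<close>-almost all \<open>\<alpha>\<close>. One \<open>\<xi>\<close> serves \<open>\<kappa>\<close> many \<open>\<beta>\<close>, say \<open>b \<eta>\<close> for \<open>\<eta> < \<kappa>\<close>. Commuting the
  quantifiers in \<open>\<forall>\<^sub>U \<eta>. \<forall>\<^sub>W \<alpha>. F \<alpha> (b \<eta>) < \<xi>\<close> now yields an \<open>\<alpha>\<close> for which \<open>F \<alpha>\<close> maps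
  \<open>\<kappa>\<close> many ordinals injectively below \<open>\<xi> < \<kappa>\<close>.
\<close>

section \<open>Ultrafilters and the exchange of their quantifiers\<close>

lemma ultrafilter_on_mono:
  "ultrafilter_on X U \<Longrightarrow> A \<in> U \<Longrightarrow> A \<subseteq> B \<Longrightarrow> B \<subseteq> X \<Longrightarrow> B \<in> U"
  unfolding ultrafilter_on_def by simp

lemma ultrafilter_on_Int: "ultrafilter_on X U \<Longrightarrow> A \<in> U \<Longrightarrow> B \<in> U \<Longrightarrow> A \<inter> B \<in> U"
  unfolding ultrafilter_on_def by simp

lemma ultrafilter_on_whole: "ultrafilter_on X U \<Longrightarrow> X \<in> U"
  unfolding ultrafilter_on_def by simp

lemma ultrafilter_on_subset:
  assumes "ultrafilter_on X U" "A \<in> U"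
  shows "A \<subseteq> X"
proof -
  have "U \<subseteq> Pow X"
    using assms(1) unfolding ultrafilter_on_def by simp
  then show ?thesis using assms(2) by blast
qed

lemma ultrafilter_on_nonempty:
  assumes "ultrafilter_on X U" "A \<in> U"
  shows "A \<noteq> {}"
proof -
  have "{} \<notin> U"
    using assms(1) unfolding ultrafilter_on_def by simp
  then show ?thesis using assms(2) by blast
qed

lemma ultrafilter_on_compl:
  assumes "ultrafilter_on X U" "{x \<in> X. P x} \<notin> U"
  shows "{x \<in> X. \<not> P x} \<in> U"
proof -
  have "X - {x \<in> X. P x} \<in> U"
    using assms unfolding ultrafilter_on_def by (metis (lifting) mem_Collect_eq subsetI)
  moreover have "X - {x \<in> X. P x} = {x \<in> X. \<not> P x}" by blast
  ultimately show ?thesis by simp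
qed

text \<open>Equality of the tensor products enters the argument in this form: the quantifiers "for
  \<open>U\<close>-almost all x" and "for \<open>W\<close>-almost all y" commute on every
  relation.\<close>

lemma left_tensor_eq_right_tensor_iff:
  assumes "left_tensor X Y U W = right_tensor X Y U W"
  shows "{x \<in> X. {y \<in> Y. R x y} \<in> W} \<in> U \<longleftrightarrow> {y \<in> Y. {x \<in> X. R x y} \<in> U} \<in> W"
proof -
  let ?R = "{(x, y). x \<in> X \<and> y \<in> Y \<and> R x y}"
  have "?R \<in> left_tensor X Y U W \<longleftrightarrow> ?R \<in> right_tensor X Y U W"
    using assms by simp
  moreover have "?R \<in> left_tensor X Y U W \<longleftrightarrow> {x \<in> X. {y \<in> Y. R x y} \<in> W} \<in> U"
    unfolding left_tensor_def by (auto cong: conj_cong)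
  moreover have "?R \<in> right_tensor X Y U W \<longleftrightarrow> {y \<in> Y. {x \<in> X. R x y} \<in> U} \<in> W"
    unfolding right_tensor_def by (auto cong: conj_cong)
  ultimately show ?thesis by simp
qed

section \<open>Uniform images from failure of indecomposability\<close>

text \<open>The pushforward of \<open>U\<close> along \<open>f\<close> is then a uniform ultrafilter
  on \<open>Field r\<close>: its members all have full cardinality. It is described through
  preimages, so no image ultrafilter has to be built.\<close>

definition uniform_image :: "'a set \<Rightarrow> 'a set set \<Rightarrow> ('a \<Rightarrow> 'c) \<Rightarrow> 'c rel \<Rightarrow> bool" where
  "uniform_image X U f r \<longleftrightarrow>
     f ` X \<subseteq> Field r \<and> (\<forall>S\<subseteq>Field r. |S| <o r \<longrightarrow> {x \<in> X. f x \<in> S} \<notin> U)"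

text \<open>Send each point to the index of a member of \<open>Q\<close> containing it. If fewer
  than \<open>r\<close> indices captured \<open>U\<close>-almost every point, the members with these
  indices would be a smaller subfamily with union in \<open>U\<close>, against minimality.\<close>

lemma uniform_imageI_minimal:
  assumes U: "ultrafilter_on X U" and r: "Card_order r"
    and Q: "\<Union>Q \<in> U" "|Q| =o r"
    and min: "\<And>Q'. Q' \<subseteq> Q \<Longrightarrow> \<Union>Q' \<in> U \<Longrightarrow> |Q| \<le>o |Q'|"
  shows "\<exists>f. uniform_image X U f r"
proof -
  have "|Q| =o |Field r|"
    using Q(2) r card_of_Field_ordIso ordIso_symmetric ordIso_transitive by blast
  then obtain h where h: "bij_betw h Q (Field r)"
    using card_of_ordIso by blast
  have "Q \<noteq> {}"
    using Q(1) ultrafilter_on_nonempty[OF U] by fastforce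
  then obtain A0 where A0: "A0 \<in> Q" by blast
  \<comment> \<open>Members of \<open>Q\<close> may overlap, so one is chosen for each point.
    Outside \<open>\<Union>Q\<close> the choice is arbitrary but still in \<open>Q\<close>, which
    keeps \<open>h \<circ> c\<close> inside \<open>Field r\<close> on all of
    \<open>X\<close>.\<close>
  have "\<forall>x. \<exists>A\<in>Q. x \<in> \<Union>Q \<longrightarrow> x \<in> A"
    using A0 by blast
  then obtain c where c: "\<And>x. c x \<in> Q" "\<And>x. x \<in> \<Union>Q \<Longrightarrow> x \<in> c x"
    by metis
  have "{x \<in> X. h (c x) \<in> S} \<notin> U" if S: "S \<subseteq> Field r" "|S| <o r" for S
  proof
    assume S_U: "{x \<in> X. h (c x) \<in> S} \<in> U"
    define Q' where "Q' = {A \<in> Q. h A \<in> S}"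
    have "\<Union>Q \<subseteq> X"
      using Q(1) by (rule ultrafilter_on_subset[OF U])
    then have "\<Union>Q' \<subseteq> X"
      unfolding Q'_def by blast
    moreover have "{x \<in> X. h (c x) \<in> S} \<inter> \<Union>Q \<subseteq> \<Union>Q'"
    proof
      fix x assume "x \<in> {x \<in> X. h (c x) \<in> S} \<inter> \<Union>Q"
      then have "h (c x) \<in> S" "x \<in> c x"
        by (simp, intro c(2), simp)
      then show "x \<in> \<Union>Q'"
        using c(1)[of x] unfolding Q'_def by blast
    qed
    ultimately have "\<Union>Q' \<in> U"
      using ultrafilter_on_mono[OF U ultrafilter_on_Int[OF U S_U Q(1)]] by simp
    then have "|Q| \<le>o |Q'|"
      by (intro min) (auto simp: Q'_def)
    moreover have "|Q'| \<le>o |S|"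
    proof (rule card_of_ordLeqI)
      show "inj_on h Q'"
        using bij_betw_imp_inj_on[OF h] by (rule inj_on_subset) (auto simp: Q'_def)
      show "\<And>A. A \<in> Q' \<Longrightarrow> h A \<in> S"
        unfolding Q'_def by blast
    qed
    ultimately have "|Q| <o r"
      using ordLeq_ordLess_trans[OF ordLeq_transitive S(2)] by blast
    then show False
      using Q(2) not_ordLess_ordIso by blast
  qed
  moreover have "(h \<circ> c) ` X \<subseteq> Field r"
    using bij_betwE[OF h] c(1) by auto
  ultimately have "uniform_image X U (h \<circ> c) r"
    unfolding uniform_image_def by simp
  then show ?thesis by blast
qed

text \<open>Among the subfamilies of a counterexample \<open>P\<close> with union in
  \<open>U\<close>, one of least cardinality has size at least \<open>\<kappa>\<close> by the
  failure and at most \<open>cardSuc \<kappa>\<close> by the bound on \<open>P\<close>, hence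
  exactly one of the two.\<close>

lemma not_indecomposable_uniform_image:
  assumes U: "ultrafilter_on X U" and k: "Card_order \<kappa>"
    and dec: "\<not> indecomposable \<kappa> (cardSuc \<kappa>) U"
  obtains f where "uniform_image X U f \<kappa>" | f where "uniform_image X U f (cardSuc \<kappa>)"
proof -
  from dec obtain P where P: "|P| \<le>o cardSuc \<kappa>" "\<Union>P \<in> U"
    and large: "\<And>Q. Q \<subseteq> P \<Longrightarrow> \<Union>Q \<in> U \<Longrightarrow> \<not> |Q| <o \<kappa>"
    unfolding indecomposable_def by blast
  let ?C = "{|Q| | Q. Q \<subseteq> P \<and> \<Union>Q \<in> U}"
  have "\<exists>r\<in>?C. \<forall>r'\<in>?C. r \<le>o r'"
    by (rule exists_minim_Card_order) (use P(2) card_of_Card_order in auto)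
  then obtain Q where Q: "Q \<subseteq> P" "\<Union>Q \<in> U"
    and "\<And>Q'. Q' \<subseteq> P \<Longrightarrow> \<Union>Q' \<in> U \<Longrightarrow> |Q| \<le>o |Q'|"
    by blast
  then have min: "\<And>Q'. Q' \<subseteq> Q \<Longrightarrow> \<Union>Q' \<in> U \<Longrightarrow> |Q| \<le>o |Q'|"
    by blast
  have wo_k: "Well_order \<kappa>"
    using k by (simp add: card_order_on_def)
  have ge: "\<kappa> \<le>o |Q|"
    using large[OF Q] not_ordLess_iff_ordLeq[OF wo_k card_of_Well_order] by blast
  have le: "|Q| \<le>o cardSuc \<kappa>"
    using P(1) Q(1) card_of_mono1 ordLeq_transitive by blast
  show ?thesis
  proof (cases "|Q| \<le>o \<kappa>")
    case True
    then have "|Q| =o \<kappa>" using ge by (simp add: ordIso_iff_ordLeq)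
    from uniform_imageI_minimal[OF U k Q(2) this min] that show ?thesis by blast
  next
    case False
    then have "\<kappa> <o |Q|"
      using not_ordLess_iff_ordLeq[OF card_of_Well_order wo_k] by blast
    then have "|Q| =o cardSuc \<kappa>"
      using le cardSuc_least[OF k card_of_Card_order] by (simp add: ordIso_iff_ordLeq)
    from uniform_imageI_minimal[OF U cardSuc_Card_order[OF k] Q(2) this min] that
    show ?thesis by blast
  qed
qed

section \<open>Initial segments are negligible for uniform images\<close>

lemma card_of_under_ordLess:
  assumes "Card_order r" "cinfinite r" "a \<in> Field r"
  shows "|under r a| <o r"
proof -
  have inf: "infinite (Field r)"
    using assms(2) by (simp add: cinfinite_def)
  then have "|{a}| <o |Field r|"
    by (simp add: finite_ordLess_infinite[OF card_of_Well_order card_of_Well_order]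
        Field_card_of)
  then have "|{a}| <o r"
    using card_of_Field_ordIso[OF assms(1)] by (rule ordLess_ordIso_trans)
  then have "|underS r a \<union> {a}| <o r"
    by (rule card_of_Un_ordLess_infinite_Field[OF inf assms(1) card_of_underS[OF assms(1,3)]])
  moreover have "under r a \<subseteq> underS r a \<union> {a}"
    unfolding under_def underS_def by blast
  ultimately show ?thesis
    using card_of_mono1 ordLeq_ordLess_trans by blast
qed

lemma not_underS_imp_under:
  assumes "Card_order r" "a \<in> Field r" "b \<in> Field r" "a \<notin> underS r b"
  shows "b \<in> under r a"
proof -
  have "Well_order r" using assms(1) by (simp add: card_order_on_def)
  then have "Linear_order r" by (simp add: well_order_on_def)
  then have "(a, b) \<in> r \<or> (b, a) \<in> r"
    using assms(2,3) 
    by (metis linear_order_on_def partial_order_on_def preorder_on_def refl_onD total_on_def)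
  moreover have "(a, a) \<in> r"
    using \<open>Linear_order r\<close> assms(2)
    by (metis linear_order_on_def partial_order_on_def preorder_on_def refl_onD)
  ultimately show ?thesis
    using assms(4) unfolding under_def underS_def by auto
qed

lemma uniform_image_eventually_above:
  assumes U: "ultrafilter_on X U" and f: "uniform_image X U f r"
    and r: "Card_order r" "cinfinite r" and a: "a \<in> Field r"
  shows "{x \<in> X. a \<in> underS r (f x)} \<in> U"
proof -
  have "{x \<in> X. f x \<in> under r a} \<notin> U"
    using f card_of_under_ordLess[OF r a] under_Field[of r a]
    unfolding uniform_image_def by blast
  then have "{x \<in> X. f x \<notin> under r a} \<in> U"
    by (rule ultrafilter_on_compl[OF U])
  moreover have "{x \<in> X. f x \<notin> under r a} \<subseteq> {x \<in> X. a \<in> underS r (f x)}"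
    using not_underS_imp_under[OF r(1) a] f unfolding uniform_image_def by blast
  ultimately show ?thesis
    by (rule ultrafilter_on_mono[OF U]) blast
qed

section \<open>The two contradictions\<close>

text \<open>For every y, \<open>U\<close>-almost all x satisfy \<open>g y < f x\<close>. After the
  exchange, a single \<open>f x\<close> bounds \<open>g\<close> on a set in \<open>W\<close>,
  although the initial segment below \<open>f x\<close> is too small for that.\<close>

lemma uniform_image_same_cardinal:
  assumes U: "ultrafilter_on X U" and W: "ultrafilter_on Y W"
    and eq: "left_tensor X Y U W = right_tensor X Y U W"
    and f: "uniform_image X U f r" and g: "uniform_image Y W g r"
    and r: "Card_order r" "cinfinite r"
  shows False
proof -
  have fX: "\<And>x. x \<in> X \<Longrightarrow> f x \<in> Field r" and gY: "\<And>y. y \<in> Y \<Longrightarrow> g y \<in> Field r"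
    using f g unfolding uniform_image_def by auto
  have "{x \<in> X. g y \<in> underS r (f x)} \<in> U" if "y \<in> Y" for y
    using uniform_image_eventually_above[OF U f r gY[OF that]] .
  then have "{y \<in> Y. {x \<in> X. g y \<in> underS r (f x)} \<in> U} = Y" by blast
  then have "{y \<in> Y. {x \<in> X. g y \<in> underS r (f x)} \<in> U} \<in> W"
    using ultrafilter_on_whole[OF W] by simp
  then have "{x \<in> X. {y \<in> Y. g y \<in> underS r (f x)} \<in> W} \<in> U"
    by (rule iffD2[OF left_tensor_eq_right_tensor_iff[OF eq]])
  then obtain x where x: "x \<in> X" "{y \<in> Y. g y \<in> underS r (f x)} \<in> W"
    using ultrafilter_on_nonempty[OF U] by blast
  have "|underS r (f x)| <o r"
    using card_of_underS[OF r(1) fX[OF x(1)]] .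
  then show False
    using g x(2) Order_Relation.underS_Field[of r "f x"] unfolding uniform_image_def by blast
qed

lemma uniform_image_successor:
  fixes \<kappa> :: "'c rel"
  assumes U: "ultrafilter_on X U" and W: "ultrafilter_on Y W"
    and eq: "left_tensor X Y U W = right_tensor X Y U W"
    and f: "uniform_image X U f \<kappa>" and g: "uniform_image Y W g (cardSuc \<kappa>)"
    and k: "Card_order \<kappa>" "cinfinite \<kappa>"
  shows False
proof -
  note comm = left_tensor_eq_right_tensor_iff[OF eq]
  let ?s = "cardSuc \<kappa>"
  have s: "Card_order ?s" "cinfinite ?s"
    using k cardSuc_Card_order Cinfinite_cardSuc by auto
  have fX: "\<And>x. x \<in> X \<Longrightarrow> f x \<in> Field \<kappa>" and gY: "\<And>y. y \<in> Y \<Longrightarrow> g y \<in> Field ?s"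
    using f g unfolding uniform_image_def by auto
  have "\<exists>F. inj_on F (underS ?s \<alpha>) \<and> F ` underS ?s \<alpha> \<subseteq> Field \<kappa>" if "\<alpha> \<in> Field ?s" for \<alpha>
  proof -
    have "|underS ?s \<alpha>| \<le>o \<kappa>"
      using card_of_underS[OF s(1) that] cardSuc_ordLeq_ordLess[OF k(1) card_of_Card_order]
      by blast
    then have "|underS ?s \<alpha>| \<le>o |Field \<kappa>|"
      using card_of_Field_ordIso[OF k(1)] ordIso_symmetric ordLeq_ordIso_trans by blast
    then show ?thesis by (simp add: card_of_ordLeq)
  qed
  then obtain F where F: "\<And>\<alpha>. \<alpha> \<in> Field ?s \<Longrightarrow> inj_on (F \<alpha>) (underS ?s \<alpha>)"
    "\<And>\<alpha>. \<alpha> \<in> Field ?s \<Longrightarrow> F \<alpha> ` underS ?s \<alpha> \<subseteq> Field \<kappa>"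
    by metis
  \<comment> \<open>The first conjunct is built in because \<open>F (g y)\<close> is injective with
    values in \<open>Field \<kappa>\<close> only on the predecessors of \<open>g y\<close>.\<close>
  define below where
    "below \<beta> \<xi> y \<longleftrightarrow> \<beta> \<in> underS ?s (g y) \<and> F (g y) \<beta> \<in> underS \<kappa> \<xi>" for \<beta> \<xi> y
  have "\<exists>\<xi>\<in>Field \<kappa>. {y \<in> Y. below \<beta> \<xi> y} \<in> W" if \<beta>: "\<beta> \<in> Field ?s" for \<beta>
  proof -
    have "{x \<in> X. below \<beta> (f x) y} \<in> U" if y: "y \<in> Y" "\<beta> \<in> underS ?s (g y)" for y
    proof -
      have "F (g y) \<beta> \<in> Field \<kappa>"
        using F(2)[OF gY[OF y(1)]] y(2) by blast
      from uniform_image_eventually_above[OF U f k this] show ?thesis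
        using y(2) by (simp add: below_def)
    qed
    then have "{y \<in> Y. \<beta> \<in> underS ?s (g y)} \<subseteq> {y \<in> Y. {x \<in> X. below \<beta> (f x) y} \<in> U}"
      by blast
    with uniform_image_eventually_above[OF W g s \<beta>]
    have "{y \<in> Y. {x \<in> X. below \<beta> (f x) y} \<in> U} \<in> W"
      by (rule ultrafilter_on_mono[OF W]) blast
    then have "{x \<in> X. {y \<in> Y. below \<beta> (f x) y} \<in> W} \<in> U"
      by (rule iffD2[OF comm])
    then show ?thesis
      using ultrafilter_on_nonempty[OF U] fX by blast
  qed
  then obtain \<xi> where \<xi>: "\<And>\<beta>. \<beta> \<in> Field ?s \<Longrightarrow> \<xi> \<beta> \<in> Field \<kappa>"
    "\<And>\<beta>. \<beta> \<in> Field ?s \<Longrightarrow> {y \<in> Y. below \<beta> (\<xi> \<beta>) y} \<in> W"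
    by metis
  define B where "B \<zeta> = {\<beta> \<in> Field ?s. \<xi> \<beta> = \<zeta>}" for \<zeta>
  \<comment> \<open>Pigeonhole: \<kappa> many fibres of \<xi>, each of size at most \<kappa>, cannot
    cover the successor cardinal.\<close>
  have "\<exists>\<zeta>\<in>Field \<kappa>. \<not> |B \<zeta>| \<le>o \<kappa>"
  proof (rule ccontr)
    assume "\<not> ?thesis"
    then have "|\<Union>\<zeta>\<in>Field \<kappa>. B \<zeta>| \<le>o \<kappa>"
      using k UNION_Cinfinite_bound[OF ordIso_imp_ordLeq[OF card_of_Field_ordIso[OF k(1)]]]
      by blast
    moreover have "(\<Union>\<zeta>\<in>Field \<kappa>. B \<zeta>) = Field ?s"
      using \<xi>(1) unfolding B_def by blast
    ultimately have "?s \<le>o \<kappa>"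
      using card_of_Field_ordIso[OF s(1)] ordIso_symmetric ordIso_ordLeq_trans by metis
    then show False
      using cardSuc_greater[OF k(1)] not_ordLess_ordLeq by blast
  qed
  then obtain \<zeta> where \<zeta>: "\<zeta> \<in> Field \<kappa>" "\<not> |B \<zeta>| \<le>o \<kappa>" by blast
  have "Well_order \<kappa>"
    using k(1) by (simp add: card_order_on_def)
  then have "\<kappa> <o |B \<zeta>|"
    using \<zeta>(2) not_ordLess_iff_ordLeq[OF card_of_Well_order] by blast
  then have "|Field \<kappa>| \<le>o |B \<zeta>|"
    using card_of_Field_ordIso[OF k(1)] ordIso_ordLeq_trans ordLess_imp_ordLeq by blast
  \<comment> \<open>Indexing part of the large fibre by \<open>Field \<kappa>\<close> lets
    \<open>U\<close> quantify over it through \<open>f\<close>.\<close>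
  then obtain b where b: "inj_on b (Field \<kappa>)" "b ` Field \<kappa> \<subseteq> B \<zeta>"
    using card_of_ordLeq by metis
  have "{y \<in> Y. below (b (f x)) \<zeta> y} \<in> W" if "x \<in> X" for x
  proof -
    have "b (f x) \<in> B \<zeta>" using b(2) fX[OF that] by blast
    then show ?thesis using \<xi>(2) unfolding B_def by blast
  qed
  then have "{x \<in> X. {y \<in> Y. below (b (f x)) \<zeta> y} \<in> W} = X" by blast
  then have "{x \<in> X. {y \<in> Y. below (b (f x)) \<zeta> y} \<in> W} \<in> U"
    using ultrafilter_on_whole[OF U] by simp
  then have "{y \<in> Y. {x \<in> X. below (b (f x)) \<zeta> y} \<in> U} \<in> W"
    by (rule iffD1[OF comm])
  then obtain y where y: "y \<in> Y" "{x \<in> X. below (b (f x)) \<zeta> y} \<in> U"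
    using ultrafilter_on_nonempty[OF W] by blast
  \<comment> \<open>The preimage of \<open>S\<close> under \<open>f\<close> is the set in
    \<open>U\<close> just found, whereas \<open>F (g y) \<circ> b\<close> injects \<open>S\<close>
    into the initial segment below \<zeta>, so \<open>S\<close> has fewer than \<kappa>
    elements.\<close>
  define S where "S = {\<eta> \<in> Field \<kappa>. below (b \<eta>) \<zeta> y}"
  have "|S| \<le>o |underS \<kappa> \<zeta>|"
  proof (rule card_of_ordLeqI)
    have "inj_on b S"
      using b(1) by (rule inj_on_subset) (auto simp: S_def)
    moreover have "inj_on (F (g y)) (b ` S)"
      using F(1)[OF gY[OF y(1)]] by (rule inj_on_subset) (auto simp: S_def below_def)
    ultimately show "inj_on (F (g y) \<circ> b) S"
      by (rule comp_inj_on)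
    show "\<And>\<eta>. \<eta> \<in> S \<Longrightarrow> (F (g y) \<circ> b) \<eta> \<in> underS \<kappa> \<zeta>"
      by (simp add: S_def below_def)
  qed
  then have "|S| <o \<kappa>"
    using card_of_underS[OF k(1) \<zeta>(1)] ordLeq_ordLess_trans by blast
  moreover have "S \<subseteq> Field \<kappa>" unfolding S_def by blast
  ultimately have "{x \<in> X. f x \<in> S} \<notin> U"
    using f unfolding uniform_image_def by blast
  moreover have "{x \<in> X. f x \<in> S} = {x \<in> X. below (b (f x)) \<zeta> y}"
    using fX unfolding S_def by blast
  ultimately show False using y(2) by simp
qed

text \<open>Exchange of quantifiers for the transposed relation. It allows \<open>U\<close> and
  \<open>W\<close> to trade places in the mixed case.\<close>

lemma left_tensor_eq_right_tensor_swap: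
  assumes "left_tensor X Y U W = right_tensor X Y U W"
  shows "left_tensor Y X W U = right_tensor Y X W U"
proof -
  have "R \<in> left_tensor Y X W U \<longleftrightarrow> R \<in> right_tensor Y X W U" for R
    using left_tensor_eq_right_tensor_iff[OF assms, of "\<lambda>x y. (y, x) \<in> R"]
    unfolding left_tensor_def right_tensor_def by blast
  then show ?thesis by blast
qed

theorem theorem2p15:
  fixes X :: "'a set" and Y :: "'b set"
    and U :: "'a set set" and W :: "'b set set"
  assumes "ultrafilter_on X U" and "ultrafilter_on Y W"
    and "left_tensor X Y U W = right_tensor X Y U W"
  shows "\<forall>\<kappa> :: 'c rel. Card_order \<kappa> \<and> cinfinite \<kappa> \<longrightarrow>
           indecomposable \<kappa> (cardSuc \<kappa>) U \<or> indecomposable \<kappa> (cardSuc \<kappa>) W"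
proof (intro allI impI, rule ccontr)
  fix \<kappa> :: "'c rel"
  assume k: "Card_order \<kappa> \<and> cinfinite \<kappa>"
    and "\<not> (indecomposable \<kappa> (cardSuc \<kappa>) U \<or> indecomposable \<kappa> (cardSuc \<kappa>) W)"
  then have decU: "\<not> indecomposable \<kappa> (cardSuc \<kappa>) U"
    and decW: "\<not> indecomposable \<kappa> (cardSuc \<kappa>) W" by auto
  have s: "Card_order (cardSuc \<kappa>)" "cinfinite (cardSuc \<kappa>)"
    using k cardSuc_Card_order Cinfinite_cardSuc by auto
  note U = assms(1) and W = assms(2) and eq = assms(3)
  note eq' = left_tensor_eq_right_tensor_swap[OF eq]
  from k have k: "Card_order \<kappa>" "cinfinite \<kappa>" by auto
  show False
  proof (rule not_indecomposable_uniform_image[OF U k(1) decU];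
      rule not_indecomposable_uniform_image[OF W k(1) decW])
    fix f g
    assume "uniform_image X U f \<kappa>" "uniform_image Y W g \<kappa>"
    then show False by (rule uniform_image_same_cardinal[OF U W eq _ _ k])
  next
    fix f g
    assume "uniform_image X U f \<kappa>" "uniform_image Y W g (cardSuc \<kappa>)"
    then show False by (rule uniform_image_successor[OF U W eq _ _ k])
  next
    fix f g
    assume "uniform_image X U f (cardSuc \<kappa>)" "uniform_image Y W g \<kappa>"
    \<comment> \<open>Here \<open>W\<close> has the image on the smaller cardinal, so the roles are
      reversed.\<close>
    then show False using uniform_image_successor[OF W U eq' _ _ k] by blast
  next
    fix f g
    assume "uniform_image X U f (cardSuc \<kappa>)" "uniform_image Y W g (cardSuc \<kappa>)"
    then show False by (rule uniform_image_same_cardinal[OF U W eq _ _ s])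
  qed
qed

end
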